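(* For admissible angles $(\theta,\phi)$ put $\tilde a=\sin\theta(\cos\phi+\sin\phi)>0$ and, for $r>1/\tilde a$, let $$F(r,\theta,\phi)=r\sin\theta\cos\phi\,\delta+r\cos\theta\,\mu+r\sin\theta\sin\phi\,(\sigma^2+\mu^2)+\frac1n\sum_{k=1}^n\sup_{x\in\mathbb{R}}\big[(x-\tau)_+^2-r\sin\theta\cos\phi\,(x-x_k)^2-r\cos\theta\,x-r\sin\theta\sin\phi\,x^2\big].$$ The solution of the dual problem $\inf_{r,\theta,\phi}F(r,\theta,\phi)$ can be computed approximately by a grid search over admissible angles $(\theta,\phi)$ where, for each fixed $(\theta,\phi)$, a linear search over $\{r:r\tilde a>1\}$ finds the extremal point $r^*$ of $F(\cdot,\theta,\phi)$, and $F$ is minimized over the resulting list of tuples. Precisely, for each admissible $(\theta,\phi)$: either there is $r^*>1/\tilde a$ with $\partial_rF(r^* )=0$ (so $F(\cdot,\theta,\phi)$ is minimized there over $r>1/\tilde a$), or the infimum of $F(\cdot,\theta,\phi)$ over $r>1/\tilde a$ is its limit as $r\downarrow1/\tilde a$. Furthermore, the partial derivative of $F$ in $r$ is continuous and at $r=r^*$ is $$\partial_rF(r^* )=\alpha-\frac{\alpha_0}n\sum_{k=1}^nx_k^2+\frac1n\Big[\sum_{k=1}^n\beta_k-\sum_{k\in K_1}\frac{\tilde a\,C_k}{(r^*\tilde a-1)^2}\Big],$$ where $\alpha_0=\sin\theta\cos\phi$, $\alpha=\alpha_0\delta+\cos\theta\,\mu+\sin\theta\sin\phi(\sigma^2+\mu^2)$,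 $\tilde b_k=\sin\theta\cos\phi\,x_k-\frac12\cos\theta$, $\beta_k=\tilde b_k^2/\tilde a$, $C_k=(\tau-\tilde b_k/\tilde a)^2$, and $K_1=\{k:\tilde b_k/\tilde a-\tau>0\}$.
   Context: Data: $n\ge1$, real numbers $x_1,\dots,x_n$, $\tau,\mu\in\mathbb{R}$, $\sigma\ge0$, $\delta\ge0$; $Q_n=\frac1n\sum_{i=1}^n\delta_{x_i}$ is the empirical measure; $(z)_+=\max(z,0)$ and $(z)_+^2=((z)_+)^2$. Angles $\theta\in[0,\pi]$, $\phi\in[0,2\pi)$ are called admissible if $\sin\theta(\cos\phi+\sin\phi)>0$ and $\sin\theta\cos\phi\ge0$. (These are the spherical coordinates $\lambda_1=r\sin\theta\cos\phi\ge0$, $\lambda_2=r\cos\theta$, $\lambda_3=r\sin\theta\sin\phi$ for the dual variables.) $\partial_r$ denotes the derivative in $r$ with $(\theta,\phi)$ fixed. Standing assumption (interior point/Slater condition): $(\mu,\sigma^2+\mu^2,\delta)$ is an interior point of the subset of $\mathbb{R}^3$ consisting of all triples $(\mathbb{E}[U],\mathbb{E}[U^2],\mathbb{E}[(U-X)^2]+s)$, where $s\ge0$ and $(U,X)$ ranges over pairs of real random variables with $X\sim Q_n$ and $\mathbb{E}[U^2]<\infty$. *)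

theory Defs
  imports "HOL-Probability.Probability"
begin

definition empirical_measure :: "nat \<Rightarrow> (nat \<Rightarrow> real) \<Rightarrow> real measure" where
  "empirical_measure n x = distr (measure_pmf (pmf_of_set {1..n})) borel x"

lemma measure_empirical_measure:
  assumes "n \<ge> 1" "A \<in> sets borel"
  shows "measure (empirical_measure n x) A
    = (1 / real n) * (\<Sum>i = 1..n. measure (return borel (x i)) A)"
proof -
  have ne: "{1..n} \<noteq> {}" using assms by auto
  have "measure (empirical_measure n x) A = measure (measure_pmf (pmf_of_set {1..n})) (x -` A)"
    unfolding empirical_measure_def using assms(2) by (subst measure_distr) auto
  also have "\<dots> = real (card ({1..n} \<inter> x -` A)) / real n"
    using ne by (subst measure_pmf_of_set) auto
  also have "real (card ({1..n} \<inter> x -` A)) = (\<Sum>i = 1..n. indicator A (x i))"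
  proof -
    have "(\<Sum>i = 1..n. indicator A (x i)) = (\<Sum>i \<in> {1..n}. if i \<in> x -` A then 1 else (0::real))"
      by (intro sum.cong) (auto simp: indicator_def)
    also have "\<dots> = real (card ({1..n} \<inter> x -` A))"
      by (simp add: sum.If_cases vimage_def)
    finally show ?thesis by simp
  qed
  also have "(\<Sum>i = 1..n. indicator A (x i)) = (\<Sum>i = 1..n. measure (return borel (x i)) A)"
    using assms(2) by (simp add: measure_return)
  finally show ?thesis by simp
qed

text \<open>
  A triple depends only on the joint law of \<open>(U, X)\<close>, which is a measure on \<open>\<real> \<times> \<real>\<close>. Hence every
  pair of real random variables, on whatever probability space, contributes a triple that also
  arises from a sample space of type \<^typ>\<open>real \<times> real\<close>, and fixing that type loses nothing.
\<close>
definition moment_set :: "nat \<Rightarrow> (nat \<Rightarrow> real) \<Rightarrow> (real \<times> real \<times> real) set" where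
  "moment_set n x =
    {(\<integral>\<omega>. U \<omega> \<partial>M, \<integral>\<omega>. (U \<omega>)\<^sup>2 \<partial>M, (\<integral>\<omega>. (U \<omega> - X \<omega>)\<^sup>2 \<partial>M) + s)
      | (M :: (real \<times> real) measure) U X s.
        prob_space M \<and> U \<in> borel_measurable M \<and> X \<in> borel_measurable M \<and>
        distr M borel X = empirical_measure n x \<and>
        integrable M (\<lambda>\<omega>. (U \<omega>)\<^sup>2) \<and> s \<ge> 0}"

definition slater :: "nat \<Rightarrow> (nat \<Rightarrow> real) \<Rightarrow> real \<Rightarrow> real \<Rightarrow> real \<Rightarrow> bool" where
  "slater n x \<mu> \<sigma> \<delta> \<longleftrightarrow> (\<mu>, \<sigma>\<^sup>2 + \<mu>\<^sup>2, \<delta>) \<in> interior (moment_set n x)"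

definition admissible :: "(real \<times> real) set" where
  "admissible = {(\<theta>, \<phi>). 0 \<le> \<theta> \<and> \<theta> \<le> pi \<and> 0 \<le> \<phi> \<and> \<phi> < 2 * pi \<and>
     sin \<theta> * (cos \<phi> + sin \<phi>) > 0 \<and> sin \<theta> * cos \<phi> \<ge> 0}"

definition a_tilde :: "real \<Rightarrow> real \<Rightarrow> real" where
  "a_tilde \<theta> \<phi> = sin \<theta> * (cos \<phi> + sin \<phi>)"

definition sup_term :: "real \<Rightarrow> real \<Rightarrow> real \<Rightarrow> real \<Rightarrow> real \<Rightarrow> real \<Rightarrow> real" where
  "sup_term \<tau> y r \<theta> \<phi> z =
     (max (z - \<tau>) 0)\<^sup>2 - r * sin \<theta> * cos \<phi> * (z - y)\<^sup>2 - r * cos \<theta> * z - r * sin \<theta> * sin \<phi> * z\<^sup>2"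

text \<open>
  The supremum is taken in \<^typ>\<open>real\<close>; it is a genuine one for \<open>r > 1 / a_tilde \<theta> \<phi>\<close>, see
  \<open>bdd_above_sup_term\<close> below.
\<close>
definition dual_fun ::
  "nat \<Rightarrow> (nat \<Rightarrow> real) \<Rightarrow> real \<Rightarrow> real \<Rightarrow> real \<Rightarrow> real \<Rightarrow> real \<Rightarrow> real \<Rightarrow> real \<Rightarrow> real" where
  "dual_fun n x \<tau> \<mu> \<sigma> \<delta> r \<theta> \<phi> =
     r * sin \<theta> * cos \<phi> * \<delta> + r * cos \<theta> * \<mu> + r * sin \<theta> * sin \<phi> * (\<sigma>\<^sup>2 + \<mu>\<^sup>2)
     + (1 / real n) * (\<Sum>k = 1..n. SUP z. sup_term \<tau> (x k) r \<theta> \<phi> z)"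

lemma bdd_above_sup_term:
  assumes "a_tilde \<theta> \<phi> > 0" "r > 1 / a_tilde \<theta> \<phi>"
  shows "bdd_above (range (sup_term \<tau> y r \<theta> \<phi>))"
proof -
  define p where "p = r * sin \<theta> * cos \<phi>"
  define q where "q = r * sin \<theta> * sin \<phi>"
  define c where "c = r * cos \<theta>"
  define A where "A = p + q - 1"
  define B where "B = 2 * p * y - c - 2 * \<tau>"
  have "r * a_tilde \<theta> \<phi> > 1" using assms by (simp add: field_simps)
  then have A: "A > 0" by (simp add: A_def p_def q_def a_tilde_def algebra_simps)
  have "sup_term \<tau> y r \<theta> \<phi> z \<le> B\<^sup>2 / (4 * A) + \<tau>\<^sup>2 - p * y\<^sup>2" for z
  proof -
    have "(max (z - \<tau>) 0)\<^sup>2 \<le> (z - \<tau>)\<^sup>2" by (auto simp: max_def)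
    then have "sup_term \<tau> y r \<theta> \<phi> z \<le> (z - \<tau>)\<^sup>2 - p * (z - y)\<^sup>2 - c * z - q * z\<^sup>2"
      by (simp add: sup_term_def p_def q_def c_def)
    also have "\<dots> = B * z - A * z\<^sup>2 + \<tau>\<^sup>2 - p * y\<^sup>2"
      by (simp add: A_def B_def power2_eq_square algebra_simps)
    also have "B * z - A * z\<^sup>2 \<le> B\<^sup>2 / (4 * A)"
    proof -
      have "0 \<le> (2 * A * z - B)\<^sup>2" by simp
      then have "(B * z - A * z\<^sup>2) * (4 * A) \<le> B\<^sup>2"
        by (simp add: power2_eq_square algebra_simps)
      then show ?thesis using A by (simp add: pos_le_divide_eq)
    qed
    finally show ?thesis by simp
  qed
  then show ?thesis by (intro bdd_aboveI) auto
qed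

definition dual_value ::
  "nat \<Rightarrow> (nat \<Rightarrow> real) \<Rightarrow> real \<Rightarrow> real \<Rightarrow> real \<Rightarrow> real \<Rightarrow> ereal" where
  "dual_value n x \<tau> \<mu> \<sigma> \<delta> =
     (INF (r, \<theta>, \<phi>) \<in> {(r, \<theta>, \<phi>). (\<theta>, \<phi>) \<in> admissible \<and> r > 1 / a_tilde \<theta> \<phi>}.
        ereal (dual_fun n x \<tau> \<mu> \<sigma> \<delta> r \<theta> \<phi>))"

definition extremal_point ::
  "nat \<Rightarrow> (nat \<Rightarrow> real) \<Rightarrow> real \<Rightarrow> real \<Rightarrow> real \<Rightarrow> real \<Rightarrow> real \<Rightarrow> real \<Rightarrow> real \<Rightarrow> bool" where
  "extremal_point n x \<tau> \<mu> \<sigma> \<delta> \<theta> \<phi> r \<longleftrightarrow>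
     r > 1 / a_tilde \<theta> \<phi> \<and> ((\<lambda>r. dual_fun n x \<tau> \<mu> \<sigma> \<delta> r \<theta> \<phi>) has_real_derivative 0) (at r)"

text \<open>
  The value recorded for the grid point \<open>(\<theta>, \<phi>)\<close>: at an extremal point if the search over
  \<open>r > 1 / a_tilde \<theta> \<phi>\<close> finds one, and otherwise the limit at the left end of that range.
\<close>
definition line_search_value ::
  "nat \<Rightarrow> (nat \<Rightarrow> real) \<Rightarrow> real \<Rightarrow> real \<Rightarrow> real \<Rightarrow> real \<Rightarrow> real \<times> real \<Rightarrow> ereal" where
  "line_search_value n x \<tau> \<mu> \<sigma> \<delta> = (\<lambda>(\<theta>, \<phi>).
     if \<exists>r. extremal_point n x \<tau> \<mu> \<sigma> \<delta> \<theta> \<phi> r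
     then ereal (dual_fun n x \<tau> \<mu> \<sigma> \<delta> (SOME r. extremal_point n x \<tau> \<mu> \<sigma> \<delta> \<theta> \<phi> r) \<theta> \<phi>)
     else Lim (at_right (1 / a_tilde \<theta> \<phi>)) (\<lambda>r. ereal (dual_fun n x \<tau> \<mu> \<sigma> \<delta> r \<theta> \<phi>)))"

definition alpha0 :: "real \<Rightarrow> real \<Rightarrow> real" where
  "alpha0 \<theta> \<phi> = sin \<theta> * cos \<phi>"

definition alpha :: "real \<Rightarrow> real \<Rightarrow> real \<Rightarrow> real \<Rightarrow> real \<Rightarrow> real" where
  "alpha \<mu> \<sigma> \<delta> \<theta> \<phi> = alpha0 \<theta> \<phi> * \<delta> + cos \<theta> * \<mu> + sin \<theta> * sin \<phi> * (\<sigma>\<^sup>2 + \<mu>\<^sup>2)"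

definition b_tilde :: "(nat \<Rightarrow> real) \<Rightarrow> real \<Rightarrow> real \<Rightarrow> nat \<Rightarrow> real" where
  "b_tilde x \<theta> \<phi> k = sin \<theta> * cos \<phi> * x k - (1 / 2) * cos \<theta>"

definition beta :: "(nat \<Rightarrow> real) \<Rightarrow> real \<Rightarrow> real \<Rightarrow> nat \<Rightarrow> real" where
  "beta x \<theta> \<phi> k = (b_tilde x \<theta> \<phi> k)\<^sup>2 / a_tilde \<theta> \<phi>"

definition C_coeff :: "(nat \<Rightarrow> real) \<Rightarrow> real \<Rightarrow> real \<Rightarrow> real \<Rightarrow> nat \<Rightarrow> real" where
  "C_coeff x \<tau> \<theta> \<phi> k = (\<tau> - b_tilde x \<theta> \<phi> k / a_tilde \<theta> \<phi>)\<^sup>2"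

definition K1 :: "nat \<Rightarrow> (nat \<Rightarrow> real) \<Rightarrow> real \<Rightarrow> real \<Rightarrow> real \<Rightarrow> nat set" where
  "K1 n x \<tau> \<theta> \<phi> = {k \<in> {1..n}. b_tilde x \<theta> \<phi> k / a_tilde \<theta> \<phi> - \<tau> > 0}"

end

theory Submission
  imports Defs
begin

text \<open>
  Completing the square in each inner supremum turns the dual function along a fixed direction
  \<open>(\<theta>, \<phi>)\<close> into
  \<open>F r = L * r + S * (r * a / (r * a - 1))\<close> for \<open>r > 1 / a\<close>, with \<open>a = a_tilde \<theta> \<phi>\<close> and \<open>S \<ge> 0\<close>
  (\<open>dual_fun_eq_ray_fun\<close>). The slope \<open>L\<close> is the value at the direction \<open>(\<theta>, \<phi>)\<close> of the dual function
  of the problem with zero objective. Weak duality makes it nonnegative whenever the moment constraints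
  are feasible, and moving the constraint vector a little against the direction, as the Slater
  condition permits, makes it strictly positive (\<open>dual_slope_pos\<close>). This is what prevents the
  infimum over \<open>r\<close> from escaping to infinity.

  With \<open>P = sqrt (L / a)\<close> and \<open>Q = sqrt S\<close> the function of one variable satisfies
  \<open>F r = (P + Q)\<^sup>2 + (P * (r * a - 1) - Q)\<^sup>2 / (r * a - 1)\<close>. Its infimum is therefore \<open>(P + Q)\<^sup>2\<close>.
  If \<open>S > 0\<close>, it is attained at the only critical point, \<open>r * a = 1 + Q / P\<close>; if \<open>S = 0\<close>, the function
  is increasing, and the infimum is the limit at \<open>1 / a\<close>. In both cases the line search returns
  \<open>(P + Q)\<^sup>2\<close>, and the derivative of \<open>F\<close> is read off from the closed form.

  The expression \<open>(P + Q)\<^sup>2\<close> depends continuously on the angles, and its infimum over the admissible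
  angles is the dual value. For the grid search it is thus enough to fix one admissible direction
  whose value is within \<open>\<epsilon>\<close> of the dual value: every sufficiently fine grid has a point close to it.
  This argument uses no uniform continuity, which matters because the admissible set is not compact:
  \<open>a\<close> can tend to \<open>0\<close> at its boundary.
\<close>

section \<open>The inner supremum\<close>

text \<open>
  With \<open>h = max (m - \<tau>) 0\<close>, the bound is \<open>max (z - \<tau>) 0 \<le> \<bar>z - m\<bar> + h\<close> followed by the weighted
  inequality \<open>2 * p * h \<le> (a - 1) * p\<^sup>2 + h\<^sup>2 / (a - 1)\<close>; both are equalities at
  \<open>z = m + h / (a - 1)\<close>.
\<close>
lemma SUP_hinge_minus_square:
  fixes a m \<tau> c :: real
  assumes "a > 1"
  shows "(SUP z. (max (z - \<tau>) 0)\<^sup>2 - a * (z - m)\<^sup>2 + c) = a / (a - 1) * (max (m - \<tau>) 0)\<^sup>2 + c"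
proof -
  define h where "h = max (m - \<tau>) 0"
  have h: "h \<ge> 0" "m - \<tau> \<le> h" by (auto simp: h_def)
  have bound: "(max (z - \<tau>) 0)\<^sup>2 - a * (z - m)\<^sup>2 \<le> a / (a - 1) * h\<^sup>2" for z
  proof -
    define p where "p = \<bar>z - m\<bar>"
    have "max (z - \<tau>) 0 \<le> p + h" using h by (auto simp: p_def)
    then have "(max (z - \<tau>) 0)\<^sup>2 \<le> (p + h)\<^sup>2" by (intro power_mono) auto
    moreover have "a * p\<^sup>2 + a / (a - 1) * h\<^sup>2 - (p + h)\<^sup>2 = ((a - 1) * p - h)\<^sup>2 / (a - 1)"
      using assms by (simp add: field_simps power2_eq_square)
    moreover have "((a - 1) * p - h)\<^sup>2 / (a - 1) \<ge> 0" using assms by simp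
    moreover have "p\<^sup>2 = (z - m)\<^sup>2" by (simp add: p_def)
    ultimately show ?thesis by simp
  qed
  \<comment> \<open>The equality case of the bound; for \<open>h = 0\<close> it is \<open>z = m\<close>, where both squares vanish.\<close>
  define z0 where "z0 = m + h / (a - 1)"
  have hinge: "max (z0 - \<tau>) 0 = a / (a - 1) * h"
    using assms by (cases "m > \<tau>") (auto simp: z0_def h_def max_def field_simps)
  have "a / (a - 1) * h\<^sup>2 = (a / (a - 1) * h)\<^sup>2 - a * (h / (a - 1))\<^sup>2"
    using assms by (simp add: divide_simps power2_eq_square) (simp add: algebra_simps)
  then have attained: "a / (a - 1) * h\<^sup>2 = (max (z0 - \<tau>) 0)\<^sup>2 - a * (z0 - m)\<^sup>2"
    by (simp add: hinge) (simp add: z0_def)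
  show ?thesis
    unfolding h_def[symmetric]
  proof (intro cSup_eq_maximum)
    show "a / (a - 1) * h\<^sup>2 + c \<in> range (\<lambda>z. (max (z - \<tau>) 0)\<^sup>2 - a * (z - m)\<^sup>2 + c)"
      using attained by auto
  qed (use bound in auto)
qed

definition dual_slope ::
  "nat \<Rightarrow> (nat \<Rightarrow> real) \<Rightarrow> real \<Rightarrow> real \<Rightarrow> real \<Rightarrow> real \<Rightarrow> real \<Rightarrow> real" where
  "dual_slope n x \<mu> \<sigma> \<delta> \<theta> \<phi> = alpha \<mu> \<sigma> \<delta> \<theta> \<phi> - alpha0 \<theta> \<phi> / real n * (\<Sum>k = 1..n. (x k)\<^sup>2)
     + (1 / real n) * (\<Sum>k = 1..n. beta x \<theta> \<phi> k)"

definition mean_sq_excess :: "nat \<Rightarrow> (nat \<Rightarrow> real) \<Rightarrow> real \<Rightarrow> real \<Rightarrow> real \<Rightarrow> real" where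
  "mean_sq_excess n x \<tau> \<theta> \<phi> =
     (1 / real n) * (\<Sum>k = 1..n. (max (b_tilde x \<theta> \<phi> k / a_tilde \<theta> \<phi> - \<tau>) 0)\<^sup>2)"

definition ray_fun :: "real \<Rightarrow> real \<Rightarrow> real \<Rightarrow> real \<Rightarrow> real" where
  "ray_fun L a S r = L * r + S * (r * a / (r * a - 1))"

lemma mean_sq_excess_nonneg: "mean_sq_excess n x \<tau> \<theta> \<phi> \<ge> 0"
  by (auto simp: mean_sq_excess_def intro!: sum_nonneg divide_nonneg_nonneg)

lemma mean_sq_excess_eq_sum_K1:
  "mean_sq_excess n x \<tau> \<theta> \<phi> = (1 / real n) * (\<Sum>k\<in>K1 n x \<tau> \<theta> \<phi>. C_coeff x \<tau> \<theta> \<phi> k)"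
proof -
  have "(\<Sum>k = 1..n. (max (b_tilde x \<theta> \<phi> k / a_tilde \<theta> \<phi> - \<tau>) 0)\<^sup>2)
      = (\<Sum>k\<in>K1 n x \<tau> \<theta> \<phi>. (max (b_tilde x \<theta> \<phi> k / a_tilde \<theta> \<phi> - \<tau>) 0)\<^sup>2)"
    by (rule sum.mono_neutral_right) (auto simp: K1_def)
  also have "\<dots> = (\<Sum>k\<in>K1 n x \<tau> \<theta> \<phi>. C_coeff x \<tau> \<theta> \<phi> k)"
    by (rule sum.cong) (auto simp: K1_def C_coeff_def power2_commute)
  finally show ?thesis by (simp add: mean_sq_excess_def)
qed

lemma SUP_sup_term:
  assumes a: "a_tilde \<theta> \<phi> > 0" and r: "r > 1 / a_tilde \<theta> \<phi>"
  shows "(SUP z. sup_term \<tau> (x k) r \<theta> \<phi> z) =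
    r * a_tilde \<theta> \<phi> / (r * a_tilde \<theta> \<phi> - 1) * (max (b_tilde x \<theta> \<phi> k / a_tilde \<theta> \<phi> - \<tau>) 0)\<^sup>2
    + r * (beta x \<theta> \<phi> k - alpha0 \<theta> \<phi> * (x k)\<^sup>2)"
proof -
  define m where "m = b_tilde x \<theta> \<phi> k / a_tilde \<theta> \<phi>"
  have am: "a_tilde \<theta> \<phi> * m = b_tilde x \<theta> \<phi> k" using a by (simp add: m_def)
  have beta: "beta x \<theta> \<phi> k = a_tilde \<theta> \<phi> * m\<^sup>2"
    using a by (simp add: beta_def m_def power2_eq_square)
  have "sup_term \<tau> (x k) r \<theta> \<phi> z = (max (z - \<tau>) 0)\<^sup>2 - (r * a_tilde \<theta> \<phi>) * (z - m)\<^sup>2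
      + r * (beta x \<theta> \<phi> k - alpha0 \<theta> \<phi> * (x k)\<^sup>2)" for z
  proof -
    have "a_tilde \<theta> \<phi> * (z - m)\<^sup>2 = a_tilde \<theta> \<phi> * z\<^sup>2 - 2 * (a_tilde \<theta> \<phi> * m) * z + beta x \<theta> \<phi> k"
      by (simp add: beta power2_eq_square algebra_simps)
    also have "\<dots> = a_tilde \<theta> \<phi> * z\<^sup>2 - 2 * b_tilde x \<theta> \<phi> k * z + beta x \<theta> \<phi> k"
      by (simp only: am)
    finally have "r * (a_tilde \<theta> \<phi> * (z - m)\<^sup>2)
        = r * (a_tilde \<theta> \<phi> * z\<^sup>2 - 2 * b_tilde x \<theta> \<phi> k * z + beta x \<theta> \<phi> k)" by simp
    then show ?thesis
      by (simp add: sup_term_def b_tilde_def alpha0_def a_tilde_def power2_eq_square algebra_simps)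
  qed
  moreover have "r * a_tilde \<theta> \<phi> > 1" using a r by (simp add: field_simps)
  ultimately show ?thesis
    using SUP_hinge_minus_square[of "r * a_tilde \<theta> \<phi>" \<tau> m] by (simp add: m_def)
qed

lemma dual_fun_eq_ray_fun:
  assumes a: "a_tilde \<theta> \<phi> > 0" and r: "r > 1 / a_tilde \<theta> \<phi>"
  shows "dual_fun n x \<tau> \<mu> \<sigma> \<delta> r \<theta> \<phi>
    = ray_fun (dual_slope n x \<mu> \<sigma> \<delta> \<theta> \<phi>) (a_tilde \<theta> \<phi>) (mean_sq_excess n x \<tau> \<theta> \<phi>) r"
proof -
  define w where "w = r * a_tilde \<theta> \<phi> / (r * a_tilde \<theta> \<phi> - 1)"
  define h where "h k = (max (b_tilde x \<theta> \<phi> k / a_tilde \<theta> \<phi> - \<tau>) 0)\<^sup>2" for k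
  have "(\<Sum>k = 1..n. SUP z. sup_term \<tau> (x k) r \<theta> \<phi> z)
      = (\<Sum>k = 1..n. w * h k + r * (beta x \<theta> \<phi> k - alpha0 \<theta> \<phi> * (x k)\<^sup>2))"
    by (simp add: SUP_sup_term[OF a r] w_def h_def)
  also have "\<dots> = w * (\<Sum>k = 1..n. h k) + r * (\<Sum>k = 1..n. beta x \<theta> \<phi> k)
      - r * alpha0 \<theta> \<phi> * (\<Sum>k = 1..n. (x k)\<^sup>2)"
    by (simp add: sum.distrib sum_subtractf sum_distrib_left right_diff_distrib mult.assoc)
  finally have sum: "(\<Sum>k = 1..n. SUP z. sup_term \<tau> (x k) r \<theta> \<phi> z) = \<dots>" .
  show ?thesis
    unfolding dual_fun_def sum ray_fun_def dual_slope_def mean_sq_excess_def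
      alpha_def alpha0_def w_def[symmetric] h_def[symmetric]
    by (simp add: algebra_simps add_divide_distrib diff_divide_distrib)
qed

section \<open>Positivity of the slope\<close>

lemma
  fixes g :: "real \<Rightarrow> real"
  assumes n: "n \<ge> 1" and X: "X \<in> borel_measurable M"
    and law: "distr M borel X = empirical_measure n x" and g: "g \<in> borel_measurable borel"
  shows integrable_empirical_law: "integrable M (\<lambda>\<omega>. g (X \<omega>))"
    and integral_empirical_law: "(\<integral>\<omega>. g (X \<omega>) \<partial>M) = (1 / real n) * (\<Sum>k = 1..n. g (x k))"
proof -
  let ?p = "pmf_of_set {1..n}"
  have ne: "{1..n} \<noteq> {}" using n by auto
  have x: "x \<in> measurable (measure_pmf ?p) borel" by simp
  have "integrable (measure_pmf ?p) (\<lambda>k. g (x k))"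
    by (rule integrable_measure_pmf_finite) (use ne in simp)
  then have "integrable (empirical_measure n x) g"
    unfolding empirical_measure_def by (simp add: integrable_distr_eq g)
  then show "integrable M (\<lambda>\<omega>. g (X \<omega>))"
    by (simp add: integrable_distr_eq[OF X g] flip: law)
  have "(\<integral>\<omega>. g (X \<omega>) \<partial>M) = integral\<^sup>L (empirical_measure n x) g"
    by (simp add: integral_distr[OF X g] flip: law)
  also have "\<dots> = (\<integral>k. g (x k) \<partial>measure_pmf ?p)"
    unfolding empirical_measure_def by (rule integral_distr[OF x g])
  also have "\<dots> = (1 / real n) * (\<Sum>k = 1..n. g (x k))"
    using ne by (simp add: integral_pmf_of_set)
  finally show "(\<integral>\<omega>. g (X \<omega>) \<partial>M) = (1 / real n) * (\<Sum>k = 1..n. g (x k))" .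
qed

text \<open>
  Weak duality for the problem with zero objective: pointwise in \<open>\<omega>\<close>, the maximum over \<open>z\<close> of the
  quadratic \<open>- alpha0 \<theta> \<phi> * (z - X \<omega>)\<^sup>2 - cos \<theta> * z - sin \<theta> * sin \<phi> * z\<^sup>2\<close> is at least its value
  at \<open>z = U \<omega>\<close>. Slack \<open>s\<close> in the third constraint only helps because \<open>alpha0 \<theta> \<phi> \<ge> 0\<close>.
\<close>
lemma weak_duality_zero_objective:
  assumes n: "n \<ge> 1" and adm: "(\<theta>, \<phi>) \<in> admissible" and q: "(q1, q2, q3) \<in> moment_set n x"
  shows "0 \<le> cos \<theta> * q1 + sin \<theta> * sin \<phi> * q2 + alpha0 \<theta> \<phi> * q3
    + (1 / real n) * (\<Sum>k = 1..n. beta x \<theta> \<phi> k - alpha0 \<theta> \<phi> * (x k)\<^sup>2)"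
proof -
  obtain M :: "(real \<times> real) measure" and U X s where
    M: "prob_space M" and U: "U \<in> borel_measurable M" and X: "X \<in> borel_measurable M"
    and law: "distr M borel X = empirical_measure n x"
    and U2: "integrable M (\<lambda>\<omega>. (U \<omega>)\<^sup>2)" and s: "s \<ge> 0"
    and q1: "q1 = (\<integral>\<omega>. U \<omega> \<partial>M)" and q2: "q2 = (\<integral>\<omega>. (U \<omega>)\<^sup>2 \<partial>M)"
    and q3: "q3 = (\<integral>\<omega>. (U \<omega> - X \<omega>)\<^sup>2 \<partial>M) + s"
    using q unfolding moment_set_def by auto
  interpret prob_space M by fact
  have a: "a_tilde \<theta> \<phi> > 0" and c0: "alpha0 \<theta> \<phi> \<ge> 0"
    using adm by (auto simp: admissible_def a_tilde_def alpha0_def)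
  define b where "b y = alpha0 \<theta> \<phi> * y - (1 / 2) * cos \<theta>" for y
  define g where "g y = (b y)\<^sup>2 / a_tilde \<theta> \<phi> - alpha0 \<theta> \<phi> * y\<^sup>2" for y
  have g: "g \<in> borel_measurable borel" unfolding g_def b_def by measurable
  have iX2: "integrable M (\<lambda>\<omega>. (X \<omega>)\<^sup>2)"
    by (rule integrable_empirical_law[OF n X law, of "\<lambda>y. y\<^sup>2"]) simp
  have iU: "integrable M U"
    by (rule square_integrable_imp_integrable[OF U U2])
  have iUX: "integrable M (\<lambda>\<omega>. (U \<omega> - X \<omega>)\<^sup>2)"
  proof (rule Bochner_Integration.integrable_bound)
    show "integrable M (\<lambda>\<omega>. 2 * (U \<omega>)\<^sup>2 + 2 * (X \<omega>)\<^sup>2)" using U2 iX2 by simp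
    have "(u - y)\<^sup>2 \<le> 2 * u\<^sup>2 + 2 * y\<^sup>2" for u y :: real
      using zero_le_power2[of "u + y"] by (simp add: power2_eq_square algebra_simps)
    then show "AE \<omega> in M. norm ((U \<omega> - X \<omega>)\<^sup>2) \<le> norm (2 * (U \<omega>)\<^sup>2 + 2 * (X \<omega>)\<^sup>2)" by simp
  qed (use U X in measurable)
  have pointwise: "- (alpha0 \<theta> \<phi> * (u - y)\<^sup>2) - cos \<theta> * u - sin \<theta> * sin \<phi> * u\<^sup>2 \<le> g y" for u y
  proof -
    have "0 \<le> (b y - a_tilde \<theta> \<phi> * u)\<^sup>2 / a_tilde \<theta> \<phi>" using a by simp
    also have "\<dots> = (b y)\<^sup>2 / a_tilde \<theta> \<phi> - 2 * b y * u + a_tilde \<theta> \<phi> * u\<^sup>2"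
      using a by (simp add: power2_eq_square field_simps)
    finally show ?thesis
      by (simp add: g_def b_def a_tilde_def alpha0_def power2_eq_square algebra_simps)
  qed
  have "- (alpha0 \<theta> \<phi> * (q3 - s)) - cos \<theta> * q1 - sin \<theta> * sin \<phi> * q2
      = (\<integral>\<omega>. - (alpha0 \<theta> \<phi> * (U \<omega> - X \<omega>)\<^sup>2) - cos \<theta> * U \<omega> - sin \<theta> * sin \<phi> * (U \<omega>)\<^sup>2 \<partial>M)"
    using iU U2 iUX by (simp add: q1 q2 q3)
  also have "\<dots> \<le> (\<integral>\<omega>. g (X \<omega>) \<partial>M)"
    using iU U2 iUX integrable_empirical_law[OF n X law g] by (intro integral_mono pointwise) auto
  also have "\<dots> = (1 / real n) * (\<Sum>k = 1..n. g (x k))"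
    by (rule integral_empirical_law[OF n X law g])
  also have "(\<Sum>k = 1..n. g (x k)) = (\<Sum>k = 1..n. beta x \<theta> \<phi> k - alpha0 \<theta> \<phi> * (x k)\<^sup>2)"
    by (simp add: g_def b_def beta_def b_tilde_def alpha0_def)
  finally show ?thesis
    using mult_nonneg_nonneg[OF c0 s] by (simp add: algebra_simps)
qed

text \<open>
  The expression in \<open>weak_duality_zero_objective\<close> equals the slope at the constraint vector \<open>p\<close> and
  depends on that vector only through its inner product with \<open>v\<close>. Since \<open>v\<close> has norm one, passing
  to \<open>p - e *\<^sub>R v\<close> lowers it by exactly \<open>e\<close>, and it is still nonnegative.
\<close>
lemma dual_slope_pos:
  assumes n: "n \<ge> 1" and sl: "slater n x \<mu> \<sigma> \<delta>" and adm: "(\<theta>, \<phi>) \<in> admissible"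
  shows "dual_slope n x \<mu> \<sigma> \<delta> \<theta> \<phi> > 0"
proof -
  define v where "v = (cos \<theta>, sin \<theta> * sin \<phi>, sin \<theta> * cos \<phi>)"
  define p where "p = (\<mu>, \<sigma>\<^sup>2 + \<mu>\<^sup>2, \<delta>)"
  have unit: "(cos \<theta>)\<^sup>2 + (sin \<theta> * sin \<phi>)\<^sup>2 + (sin \<theta> * cos \<phi>)\<^sup>2 = 1"
  proof -
    have "(cos \<theta>)\<^sup>2 + (sin \<theta> * sin \<phi>)\<^sup>2 + (sin \<theta> * cos \<phi>)\<^sup>2
        = (cos \<theta>)\<^sup>2 + (sin \<theta>)\<^sup>2 * ((sin \<phi>)\<^sup>2 + (cos \<phi>)\<^sup>2)"
      by (simp only: power_mult_distrib distrib_left add.assoc)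
    then show ?thesis by (simp only: sin_cos_squared_add sin_cos_squared_add2 mult_1_right)
  qed
  then have norm_v: "norm v = 1" by (simp add: v_def norm_Pair flip: add.assoc)
  obtain e where e: "e > 0" "cball p e \<subseteq> moment_set n x"
    using sl unfolding slater_def p_def mem_interior_cball by blast
  have "p - e *\<^sub>R v \<in> cball p e" using e(1) norm_v by (simp add: dist_norm)
  then have "(\<mu> - e * cos \<theta>, \<sigma>\<^sup>2 + \<mu>\<^sup>2 - e * (sin \<theta> * sin \<phi>), \<delta> - e * (sin \<theta> * cos \<phi>))
      \<in> moment_set n x"
    using e(2) by (auto simp: p_def v_def)
  from weak_duality_zero_objective[OF n adm this]
  have "0 \<le> dual_slope n x \<mu> \<sigma> \<delta> \<theta> \<phi>
      - e * ((cos \<theta>)\<^sup>2 + (sin \<theta> * sin \<phi>)\<^sup>2 + (sin \<theta> * cos \<phi>)\<^sup>2)"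
    by (simp add: dual_slope_def alpha_def alpha0_def sum_subtractf power2_eq_square
        right_diff_distrib algebra_simps flip: sum_distrib_left)
  then show ?thesis using e(1) unit by simp
qed

section \<open>Minimisation along a ray\<close>

definition ray_min :: "real \<Rightarrow> real \<Rightarrow> real \<Rightarrow> real" where
  "ray_min L a S = (sqrt (L / a) + sqrt S)\<^sup>2"

lemma ray_fun_eq_ray_min_plus:
  assumes "a > 0" "L > 0" "S \<ge> 0" "r > 1 / a"
  shows "ray_fun L a S r
    = ray_min L a S + (sqrt (L / a) * (r * a - 1) - sqrt S)\<^sup>2 / (r * a - 1)"
proof -
  define P Q u where "P = sqrt (L / a)" "Q = sqrt S" "u = r * a - 1"
  have u: "u > 0" using assms by (simp add: P_Q_u_def field_simps)
  have "P\<^sup>2 = L / a" and Q: "Q\<^sup>2 = S" using assms by (auto simp: P_Q_u_def)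
  then have "L * r = P\<^sup>2 * (u + 1)" using assms by (simp add: P_Q_u_def)
  moreover have "r * a = u + 1" by (simp add: P_Q_u_def)
  ultimately have "ray_fun L a S r = P\<^sup>2 * (u + 1) + Q\<^sup>2 * ((u + 1) / u)"
    by (simp add: ray_fun_def Q)
  also have "\<dots> = (P + Q)\<^sup>2 + (P * u - Q)\<^sup>2 / u"
    using u by (simp add: field_simps power2_eq_square)
  finally show ?thesis by (simp add: ray_min_def P_Q_u_def)
qed

lemma ray_min_le_ray_fun:
  assumes "a > 0" "L > 0" "S \<ge> 0" "r > 1 / a"
  shows "ray_min L a S \<le> ray_fun L a S r"
proof -
  have "r * a - 1 > 0" using assms by (simp add: field_simps)
  then show ?thesis using ray_fun_eq_ray_min_plus[OF assms] by simp
qed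

lemma has_derivative_ray_fun:
  assumes "a > 0" "r > 1 / a"
  shows "(ray_fun L a S has_real_derivative L - a * S / (r * a - 1)\<^sup>2) (at r)"
proof -
  have "r * a - 1 \<noteq> 0" using assms by (simp add: field_simps)
  then show ?thesis
    unfolding ray_fun_def[abs_def]
    by (auto intro!: derivative_eq_intros simp: power2_eq_square field_simps)
qed

lemma ray_fun_critical_iff:
  fixes L a S r :: real
  assumes "a > 0" "L > 0" "S \<ge> 0" "r > 1 / a"
  shows "L - a * S / (r * a - 1)\<^sup>2 = 0 \<longleftrightarrow> sqrt (L / a) * (r * a - 1) = sqrt S"
proof -
  have u: "r * a - 1 > 0" using assms by (simp add: field_simps)
  have "L - a * S / (r * a - 1)\<^sup>2 = 0 \<longleftrightarrow> L / a * (r * a - 1)\<^sup>2 = S"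
    using u assms by (auto simp: field_simps)
  also have "L / a * (r * a - 1)\<^sup>2 = (sqrt (L / a) * (r * a - 1))\<^sup>2"
    using assms by (simp add: power_mult_distrib)
  also have "\<dots> = S \<longleftrightarrow> sqrt (L / a) * (r * a - 1) = sqrt S"
    using u assms by (metis less_imp_le mult_nonneg_nonneg divide_nonneg_nonneg real_sqrt_ge_zero
        real_sqrt_pow2 real_sqrt_unique)
  finally show ?thesis .
qed

lemma ray_fun_critical_exists:
  fixes L a S :: real
  assumes "a > 0" "L > 0" "S > 0"
  shows "\<exists>r>1 / a. L - a * S / (r * a - 1)\<^sup>2 = 0"
proof -
  define r where "r = (1 + sqrt S / sqrt (L / a)) / a"
  have "r > 1 / a" using assms by (auto simp: r_def intro!: divide_strict_right_mono)
  moreover have "sqrt (L / a) * (r * a - 1) = sqrt S" using assms by (simp add: r_def)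
  ultimately show ?thesis using ray_fun_critical_iff[of a L S r] assms by auto
qed

lemma ray_fun_tendsto_ray_min:
  assumes "a > 0" "L > 0"
  shows "(ray_fun L a 0 \<longlongrightarrow> ray_min L a 0) (at_right (1 / a))"
proof -
  have "((\<lambda>r. L * r) \<longlongrightarrow> L * (1 / a)) (at_right (1 / a))" by (intro tendsto_intros)
  moreover have "ray_min L a 0 = L * (1 / a)" using assms by (simp add: ray_min_def)
  ultimately show ?thesis by (simp add: ray_fun_def[abs_def])
qed

section \<open>The line search\<close>

definition line_min ::
  "nat \<Rightarrow> (nat \<Rightarrow> real) \<Rightarrow> real \<Rightarrow> real \<Rightarrow> real \<Rightarrow> real \<Rightarrow> real \<times> real \<Rightarrow> real" where
  "line_min n x \<tau> \<mu> \<sigma> \<delta> = (\<lambda>(\<theta>, \<phi>).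
     ray_min (dual_slope n x \<mu> \<sigma> \<delta> \<theta> \<phi>) (a_tilde \<theta> \<phi>) (mean_sq_excess n x \<tau> \<theta> \<phi>))"

lemma admissible_a_tilde_pos: "(\<theta>, \<phi>) \<in> admissible \<Longrightarrow> a_tilde \<theta> \<phi> > 0"
  by (simp add: admissible_def a_tilde_def)

lemma has_derivative_dual_fun:
  assumes a: "a_tilde \<theta> \<phi> > 0" and r: "r > 1 / a_tilde \<theta> \<phi>"
  shows "((\<lambda>r. dual_fun n x \<tau> \<mu> \<sigma> \<delta> r \<theta> \<phi>) has_real_derivative
    dual_slope n x \<mu> \<sigma> \<delta> \<theta> \<phi>
      - a_tilde \<theta> \<phi> * mean_sq_excess n x \<tau> \<theta> \<phi> / (r * a_tilde \<theta> \<phi> - 1)\<^sup>2) (at r)"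
  by (rule has_field_derivative_transform_within_open[OF has_derivative_ray_fun[OF a r]
        open_greaterThan[of "1 / a_tilde \<theta> \<phi>"]])
    (use r dual_fun_eq_ray_fun[OF a] in auto)

lemma continuous_on_deriv_dual_fun:
  assumes a: "a_tilde \<theta> \<phi> > 0"
  shows "continuous_on {1 / a_tilde \<theta> \<phi><..} (deriv (\<lambda>r. dual_fun n x \<tau> \<mu> \<sigma> \<delta> r \<theta> \<phi>))"
proof -
  have "continuous_on {1 / a_tilde \<theta> \<phi><..} (\<lambda>r. dual_slope n x \<mu> \<sigma> \<delta> \<theta> \<phi>
      - a_tilde \<theta> \<phi> * mean_sq_excess n x \<tau> \<theta> \<phi> / (r * a_tilde \<theta> \<phi> - 1)\<^sup>2)"
    using a by (intro continuous_intros) (auto simp: field_simps)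
  then show ?thesis
    by (rule continuous_on_eq) (use DERIV_imp_deriv[OF has_derivative_dual_fun[OF a]] in auto)
qed

lemma extremal_point_iff:
  assumes "a_tilde \<theta> \<phi> > 0"
  shows "extremal_point n x \<tau> \<mu> \<sigma> \<delta> \<theta> \<phi> r \<longleftrightarrow> r > 1 / a_tilde \<theta> \<phi> \<and>
    dual_slope n x \<mu> \<sigma> \<delta> \<theta> \<phi>
      - a_tilde \<theta> \<phi> * mean_sq_excess n x \<tau> \<theta> \<phi> / (r * a_tilde \<theta> \<phi> - 1)\<^sup>2 = 0"
  using has_derivative_dual_fun[OF assms] DERIV_unique unfolding extremal_point_def by metis

context
  fixes n :: nat and x :: "nat \<Rightarrow> real" and \<tau> \<mu> \<sigma> \<delta> \<theta> \<phi> :: real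
  assumes a_pos: "a_tilde \<theta> \<phi> > 0" and slope_pos: "dual_slope n x \<mu> \<sigma> \<delta> \<theta> \<phi> > 0"
begin

lemma line_min_le_dual_fun:
  "r > 1 / a_tilde \<theta> \<phi> \<Longrightarrow> line_min n x \<tau> \<mu> \<sigma> \<delta> (\<theta>, \<phi>) \<le> dual_fun n x \<tau> \<mu> \<sigma> \<delta> r \<theta> \<phi>"
  using ray_min_le_ray_fun[OF a_pos slope_pos mean_sq_excess_nonneg] dual_fun_eq_ray_fun[OF a_pos]
  by (simp add: line_min_def)

lemma dual_fun_extremal_point:
  assumes "extremal_point n x \<tau> \<mu> \<sigma> \<delta> \<theta> \<phi> r"
  shows "dual_fun n x \<tau> \<mu> \<sigma> \<delta> r \<theta> \<phi> = line_min n x \<tau> \<mu> \<sigma> \<delta> (\<theta>, \<phi>)"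
proof -
  have r: "r > 1 / a_tilde \<theta> \<phi>" using assms by (simp add: extremal_point_def)
  have "sqrt (dual_slope n x \<mu> \<sigma> \<delta> \<theta> \<phi> / a_tilde \<theta> \<phi>) * (r * a_tilde \<theta> \<phi> - 1)
      = sqrt (mean_sq_excess n x \<tau> \<theta> \<phi>)"
    using assms unfolding extremal_point_iff[OF a_pos]
      ray_fun_critical_iff[OF a_pos slope_pos mean_sq_excess_nonneg r] by blast
  then show ?thesis
    by (simp add: line_min_def dual_fun_eq_ray_fun[OF a_pos r]
        ray_fun_eq_ray_min_plus[OF a_pos slope_pos mean_sq_excess_nonneg r])
qed

text \<open>A direction has no critical point only if \<open>mean_sq_excess\<close> vanishes, and then the dual function is linear in \<open>r\<close>.\<close>
lemma dual_fun_tendsto_line_min: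
  assumes "\<nexists>r. extremal_point n x \<tau> \<mu> \<sigma> \<delta> \<theta> \<phi> r"
  shows "((\<lambda>r. ereal (dual_fun n x \<tau> \<mu> \<sigma> \<delta> r \<theta> \<phi>)) \<longlongrightarrow> ereal (line_min n x \<tau> \<mu> \<sigma> \<delta> (\<theta>, \<phi>)))
    (at_right (1 / a_tilde \<theta> \<phi>))"
proof -
  have S: "mean_sq_excess n x \<tau> \<theta> \<phi> = 0"
    using assms ray_fun_critical_exists[OF a_pos slope_pos, of "mean_sq_excess n x \<tau> \<theta> \<phi>"]
      mean_sq_excess_nonneg[of n x \<tau> \<theta> \<phi>] extremal_point_iff[OF a_pos] by fastforce
  have "\<forall>\<^sub>F r in at_right (1 / a_tilde \<theta> \<phi>).
      ray_fun (dual_slope n x \<mu> \<sigma> \<delta> \<theta> \<phi>) (a_tilde \<theta> \<phi>) 0 r = dual_fun n x \<tau> \<mu> \<sigma> \<delta> r \<theta> \<phi>"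
    using eventually_at_right_less
    by (rule eventually_mono) (simp add: dual_fun_eq_ray_fun[OF a_pos] S)
  from Lim_transform_eventually[OF ray_fun_tendsto_ray_min[OF a_pos slope_pos] this]
  show ?thesis by (intro tendsto_ereal) (simp add: line_min_def S)
qed

lemma line_search_value_eq_line_min:
  "line_search_value n x \<tau> \<mu> \<sigma> \<delta> (\<theta>, \<phi>) = ereal (line_min n x \<tau> \<mu> \<sigma> \<delta> (\<theta>, \<phi>))"
proof (cases "\<exists>r. extremal_point n x \<tau> \<mu> \<sigma> \<delta> \<theta> \<phi> r")
  case True
  then show ?thesis
    using dual_fun_extremal_point[OF someI_ex[OF True]] by (simp add: line_search_value_def)
next
  case False
  show ?thesis
    unfolding line_search_value_def prod.case if_not_P[OF False]
    by (rule tendsto_Lim[OF trivial_limit_at_right_real dual_fun_tendsto_line_min[OF False]])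
qed

lemma INF_dual_fun_eq_line_min:
  "(INF r\<in>{1 / a_tilde \<theta> \<phi><..}. ereal (dual_fun n x \<tau> \<mu> \<sigma> \<delta> r \<theta> \<phi>))
    = ereal (line_min n x \<tau> \<mu> \<sigma> \<delta> (\<theta>, \<phi>))" (is "?I = _")
proof (rule antisym)
  show "ereal (line_min n x \<tau> \<mu> \<sigma> \<delta> (\<theta>, \<phi>)) \<le> ?I"
    by (rule INF_greatest) (simp add: line_min_le_dual_fun)
  show "?I \<le> ereal (line_min n x \<tau> \<mu> \<sigma> \<delta> (\<theta>, \<phi>))"
  proof (cases "\<exists>r. extremal_point n x \<tau> \<mu> \<sigma> \<delta> \<theta> \<phi> r")
    case True
    then obtain r where r: "extremal_point n x \<tau> \<mu> \<sigma> \<delta> \<theta> \<phi> r" by blast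
    then have "r \<in> {1 / a_tilde \<theta> \<phi><..}" by (simp add: extremal_point_def)
    then show ?thesis by (rule INF_lower2) (simp add: dual_fun_extremal_point[OF r])
  next
    case False
    have "\<forall>\<^sub>F r in at_right (1 / a_tilde \<theta> \<phi>). ?I \<le> ereal (dual_fun n x \<tau> \<mu> \<sigma> \<delta> r \<theta> \<phi>)"
      using eventually_at_right_less by (rule eventually_mono) (auto intro: INF_lower)
    then show ?thesis
      by (rule tendsto_lowerbound[OF dual_fun_tendsto_line_min[OF False]]) simp
  qed
qed

end

section \<open>The grid search\<close>

lemma dual_value_eq_INF_line_min:
  assumes n: "n \<ge> 1" and sl: "slater n x \<mu> \<sigma> \<delta>"
  shows "dual_value n x \<tau> \<mu> \<sigma> \<delta> = (INF p\<in>admissible. ereal (line_min n x \<tau> \<mu> \<sigma> \<delta> p))"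
proof (rule antisym)
  note pos = admissible_a_tilde_pos dual_slope_pos[OF n sl]
  show "dual_value n x \<tau> \<mu> \<sigma> \<delta> \<le> (INF p\<in>admissible. ereal (line_min n x \<tau> \<mu> \<sigma> \<delta> p))"
  proof (rule INF_greatest, clarify)
    fix \<theta> \<phi> assume adm: "(\<theta>, \<phi>) \<in> admissible"
    have "dual_value n x \<tau> \<mu> \<sigma> \<delta>
        \<le> (INF r\<in>{1 / a_tilde \<theta> \<phi><..}. ereal (dual_fun n x \<tau> \<mu> \<sigma> \<delta> r \<theta> \<phi>))"
      unfolding dual_value_def
    proof (rule INF_greatest)
      fix r assume "r \<in> {1 / a_tilde \<theta> \<phi><..}"
      with adm show "(INF (r, \<theta>, \<phi>)\<in>{(r, \<theta>, \<phi>). (\<theta>, \<phi>) \<in> admissible \<and> r > 1 / a_tilde \<theta> \<phi>}.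
          ereal (dual_fun n x \<tau> \<mu> \<sigma> \<delta> r \<theta> \<phi>)) \<le> ereal (dual_fun n x \<tau> \<mu> \<sigma> \<delta> r \<theta> \<phi>)"
        by (intro INF_lower2[of "(r, \<theta>, \<phi>)"]) auto
    qed
    then show "dual_value n x \<tau> \<mu> \<sigma> \<delta> \<le> ereal (line_min n x \<tau> \<mu> \<sigma> \<delta> (\<theta>, \<phi>))"
      using INF_dual_fun_eq_line_min[OF pos[OF adm]] by simp
  qed
  show "(INF p\<in>admissible. ereal (line_min n x \<tau> \<mu> \<sigma> \<delta> p)) \<le> dual_value n x \<tau> \<mu> \<sigma> \<delta>"
    unfolding dual_value_def
  proof (rule INF_greatest, clarify)
    fix r \<theta> \<phi> assume "(\<theta>, \<phi>) \<in> admissible" "r > 1 / a_tilde \<theta> \<phi>"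
    then show "(INF p\<in>admissible. ereal (line_min n x \<tau> \<mu> \<sigma> \<delta> p))
        \<le> ereal (dual_fun n x \<tau> \<mu> \<sigma> \<delta> r \<theta> \<phi>)"
      using line_min_le_dual_fun[OF pos] by (intro INF_lower2[of "(\<theta>, \<phi>)"]) auto
  qed
qed

lemma continuous_on_line_min:
  assumes "n \<ge> 1"
  shows "continuous_on admissible (line_min n x \<tau> \<mu> \<sigma> \<delta>)"
proof -
  have "sin (fst p) * (cos (snd p) + sin (snd p)) \<noteq> 0" if "p \<in> admissible" for p
    using that by (auto simp: admissible_def)
  then show ?thesis
    unfolding line_min_def ray_min_def dual_slope_def mean_sq_excess_def alpha_def alpha0_def
      beta_def b_tilde_def a_tilde_def case_prod_beta
    by (intro continuous_intros) (use assms in auto)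
qed

text \<open>
  The grid minimum never lies below the infimum. For the other inequality it suffices that some grid
  point falls close to one fixed near-optimal point, so continuity at that point alone determines
  the mesh size.
\<close>
lemma Min_fine_grid_approx_INF:
  fixes V :: "'a::metric_space \<Rightarrow> real"
  assumes cont: "continuous_on A V" and ne: "A \<noteq> {}" and low: "\<And>p. p \<in> A \<Longrightarrow> c \<le> V p"
    and \<epsilon>: "\<epsilon> > 0"
  shows "\<exists>\<eta>>0. \<forall>G. finite G \<and> G \<subseteq> A \<and> (\<forall>p\<in>A. \<exists>g\<in>G. dist p g < \<eta>) \<longrightarrow>
    \<bar>Min ((\<lambda>p. ereal (V p)) ` G) - (INF p\<in>A. ereal (V p))\<bar> < ereal \<epsilon>"
proof -
  let ?I = "INF p\<in>A. ereal (V p)"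
  obtain p1 where p1: "p1 \<in> A" using ne by blast
  have "ereal c \<le> ?I" by (rule INF_greatest) (simp add: low)
  moreover have "?I \<le> ereal (V p1)" by (rule INF_lower[OF p1])
  ultimately obtain D where D: "?I = ereal D" by (cases ?I) auto
  have "?I < ereal (D + \<epsilon>)" using D \<epsilon> by simp
  then obtain p0 where p0: "p0 \<in> A" "V p0 < D + \<epsilon>" by (auto simp: INF_less_iff)
  obtain \<eta> where \<eta>: "\<eta> > 0" "\<And>g. g \<in> A \<Longrightarrow> dist g p0 < \<eta> \<Longrightarrow> dist (V g) (V p0) < D + \<epsilon> - V p0"
    using cont p0 unfolding continuous_on_iff by (metis diff_gt_0_iff_gt)
  show ?thesis
  proof (intro exI conjI allI impI)
    show "\<eta> > 0" by fact
    fix G assume G: "finite G \<and> G \<subseteq> A \<and> (\<forall>p\<in>A. \<exists>g\<in>G. dist p g < \<eta>)"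
    then obtain g where g: "g \<in> G" "dist p0 g < \<eta>" using p0 by blast
    then have "V g < D + \<epsilon>" using \<eta>(2)[of g] G by (auto simp: dist_commute dist_real_def)
    have "Min ((\<lambda>p. ereal (V p)) ` G) \<in> (\<lambda>p. ereal (V p)) ` G"
      using G g by (intro Min_in) auto
    then obtain h where h: "h \<in> G" "Min ((\<lambda>p. ereal (V p)) ` G) = ereal (V h)" by auto
    have "ereal (V h) \<le> ereal (V g)"
      unfolding h(2)[symmetric] using G g by (intro Min_le) auto
    moreover have "?I \<le> ereal (V h)" using G h by (intro INF_lower) auto
    ultimately show "\<bar>Min ((\<lambda>p. ereal (V p)) ` G) - ?I\<bar> < ereal \<epsilon>"
      using \<open>V g < D + \<epsilon>\<close> D h(2) by simp
  qed
qed

lemma admissible_nonempty: "admissible \<noteq> {}"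
proof -
  have "(pi / 2, 0) \<in> admissible" using pi_gt_zero by (simp add: admissible_def)
  then show ?thesis by blast
qed


theorem proposition3p6:
  fixes n :: nat and x :: "nat \<Rightarrow> real" and \<tau> \<mu> \<sigma> \<delta> :: real
  assumes "n \<ge> 1" and "\<sigma> \<ge> 0" and "\<delta> \<ge> 0"
    and "slater n x \<mu> \<sigma> \<delta>"
  shows
    "(\<forall>\<epsilon>>0. \<exists>\<eta>>0. \<forall>G. finite G \<and> G \<subseteq> admissible \<and> (\<forall>p\<in>admissible. \<exists>g\<in>G. dist p g < \<eta>) \<longrightarrow>
        \<bar>Min (line_search_value n x \<tau> \<mu> \<sigma> \<delta> ` G) - dual_value n x \<tau> \<mu> \<sigma> \<delta>\<bar> < ereal \<epsilon>)
     \<and> (\<forall>\<theta> \<phi>. (\<theta>, \<phi>) \<in> admissible \<longrightarrow>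
        (let F = (\<lambda>r. dual_fun n x \<tau> \<mu> \<sigma> \<delta> r \<theta> \<phi>); a = a_tilde \<theta> \<phi> in
          ((\<exists>rs>1/a. (F has_real_derivative 0) (at rs) \<and> (\<forall>r>1/a. F rs \<le> F r))
            \<or> ((\<lambda>r. ereal (F r)) \<longlongrightarrow> (INF r\<in>{1/a<..}. ereal (F r))) (at_right (1/a)))
          \<and> continuous_on {1/a<..} (deriv F)
          \<and> (\<forall>rs>1/a. (F has_real_derivative
                (alpha \<mu> \<sigma> \<delta> \<theta> \<phi> - alpha0 \<theta> \<phi> / real n * (\<Sum>k = 1..n. (x k)\<^sup>2)
                 + (1 / real n) * ((\<Sum>k = 1..n. beta x \<theta> \<phi> k)
                     - (\<Sum>k\<in>K1 n x \<tau> \<theta> \<phi>. a * C_coeff x \<tau> \<theta> \<phi> k / (rs * a - 1)\<^sup>2))))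
              (at rs))))"
proof -
  note n = assms(1) and sl = assms(4)
  have grid: "\<exists>\<eta>>0. \<forall>G. finite G \<and> G \<subseteq> admissible \<and> (\<forall>p\<in>admissible. \<exists>g\<in>G. dist p g < \<eta>) \<longrightarrow>
      \<bar>Min (line_search_value n x \<tau> \<mu> \<sigma> \<delta> ` G) - dual_value n x \<tau> \<mu> \<sigma> \<delta>\<bar> < ereal \<epsilon>"
    if "\<epsilon> > 0" for \<epsilon> :: real
  proof -
    have "line_min n x \<tau> \<mu> \<sigma> \<delta> p \<ge> 0" for p by (simp add: line_min_def ray_min_def case_prod_beta)
    from Min_fine_grid_approx_INF[OF continuous_on_line_min[OF n] admissible_nonempty this that]
    obtain \<eta> where "\<eta> > 0" and \<eta>: "\<And>G. finite G \<and> G \<subseteq> admissible \<and>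
        (\<forall>p\<in>admissible. \<exists>g\<in>G. dist p g < \<eta>) \<Longrightarrow>
        \<bar>Min ((\<lambda>p. ereal (line_min n x \<tau> \<mu> \<sigma> \<delta> p)) ` G) - dual_value n x \<tau> \<mu> \<sigma> \<delta>\<bar> < ereal \<epsilon>"
      unfolding dual_value_eq_INF_line_min[OF n sl] by blast
    have "line_search_value n x \<tau> \<mu> \<sigma> \<delta> ` G = (\<lambda>p. ereal (line_min n x \<tau> \<mu> \<sigma> \<delta> p)) ` G"
      if "G \<subseteq> admissible" for G
      using that line_search_value_eq_line_min[OF admissible_a_tilde_pos dual_slope_pos[OF n sl]]
      by (intro image_cong) auto
    then show ?thesis using \<open>\<eta> > 0\<close> \<eta> by (intro exI[of _ \<eta>]) simp
  qed
  have search: "let F = (\<lambda>r. dual_fun n x \<tau> \<mu> \<sigma> \<delta> r \<theta> \<phi>); a = a_tilde \<theta> \<phi> in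
      ((\<exists>rs>1/a. (F has_real_derivative 0) (at rs) \<and> (\<forall>r>1/a. F rs \<le> F r))
        \<or> ((\<lambda>r. ereal (F r)) \<longlongrightarrow> (INF r\<in>{1/a<..}. ereal (F r))) (at_right (1/a)))
      \<and> continuous_on {1/a<..} (deriv F)
      \<and> (\<forall>rs>1/a. (F has_real_derivative
            (alpha \<mu> \<sigma> \<delta> \<theta> \<phi> - alpha0 \<theta> \<phi> / real n * (\<Sum>k = 1..n. (x k)\<^sup>2)
             + (1 / real n) * ((\<Sum>k = 1..n. beta x \<theta> \<phi> k)
                 - (\<Sum>k\<in>K1 n x \<tau> \<theta> \<phi>. a * C_coeff x \<tau> \<theta> \<phi> k / (rs * a - 1)\<^sup>2))))
          (at rs))"
    if adm: "(\<theta>, \<phi>) \<in> admissible" for \<theta> \<phi>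
    unfolding Let_def
  proof (intro conjI allI impI)
    note a = admissible_a_tilde_pos[OF adm]
    note slope = dual_slope_pos[OF n sl adm]
    show "(\<exists>rs>1 / a_tilde \<theta> \<phi>. ((\<lambda>r. dual_fun n x \<tau> \<mu> \<sigma> \<delta> r \<theta> \<phi>) has_real_derivative 0) (at rs)
          \<and> (\<forall>r>1 / a_tilde \<theta> \<phi>. dual_fun n x \<tau> \<mu> \<sigma> \<delta> rs \<theta> \<phi> \<le> dual_fun n x \<tau> \<mu> \<sigma> \<delta> r \<theta> \<phi>))
        \<or> ((\<lambda>r. ereal (dual_fun n x \<tau> \<mu> \<sigma> \<delta> r \<theta> \<phi>)) \<longlongrightarrow>
            (INF r\<in>{1 / a_tilde \<theta> \<phi><..}. ereal (dual_fun n x \<tau> \<mu> \<sigma> \<delta> r \<theta> \<phi>)))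
          (at_right (1 / a_tilde \<theta> \<phi>))"
    proof (cases "\<exists>r. extremal_point n x \<tau> \<mu> \<sigma> \<delta> \<theta> \<phi> r")
      case True
      then obtain rs where rs: "extremal_point n x \<tau> \<mu> \<sigma> \<delta> \<theta> \<phi> rs" by blast
      show ?thesis
        using rs line_min_le_dual_fun[OF a slope] dual_fun_extremal_point[OF a slope rs]
        by (auto simp: extremal_point_def intro!: disjI1 exI[of _ rs])
    next
      case False
      then show ?thesis
        using dual_fun_tendsto_line_min[OF a slope False] INF_dual_fun_eq_line_min[OF a slope]
        by simp
    qed
    show "continuous_on {1 / a_tilde \<theta> \<phi><..} (deriv (\<lambda>r. dual_fun n x \<tau> \<mu> \<sigma> \<delta> r \<theta> \<phi>))"
      by (rule continuous_on_deriv_dual_fun[OF a])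
    fix rs assume rs: "rs > 1 / a_tilde \<theta> \<phi>"
    let ?w = "a_tilde \<theta> \<phi> / (rs * a_tilde \<theta> \<phi> - 1)\<^sup>2"
    have "(\<Sum>k\<in>K1 n x \<tau> \<theta> \<phi>. a_tilde \<theta> \<phi> * C_coeff x \<tau> \<theta> \<phi> k / (rs * a_tilde \<theta> \<phi> - 1)\<^sup>2)
        = ?w * (\<Sum>k\<in>K1 n x \<tau> \<theta> \<phi>. C_coeff x \<tau> \<theta> \<phi> k)"
      by (simp add: sum_distrib_left)
    then have "alpha \<mu> \<sigma> \<delta> \<theta> \<phi> - alpha0 \<theta> \<phi> / real n * (\<Sum>k = 1..n. (x k)\<^sup>2)
          + (1 / real n) * ((\<Sum>k = 1..n. beta x \<theta> \<phi> k)
            - (\<Sum>k\<in>K1 n x \<tau> \<theta> \<phi>. a_tilde \<theta> \<phi> * C_coeff x \<tau> \<theta> \<phi> k / (rs * a_tilde \<theta> \<phi> - 1)\<^sup>2))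
        = dual_slope n x \<mu> \<sigma> \<delta> \<theta> \<phi>
          - a_tilde \<theta> \<phi> * mean_sq_excess n x \<tau> \<theta> \<phi> / (rs * a_tilde \<theta> \<phi> - 1)\<^sup>2"
      by (simp add: dual_slope_def mean_sq_excess_eq_sum_K1 right_diff_distrib diff_divide_distrib)
    then show "((\<lambda>r. dual_fun n x \<tau> \<mu> \<sigma> \<delta> r \<theta> \<phi>) has_real_derivative
        (alpha \<mu> \<sigma> \<delta> \<theta> \<phi> - alpha0 \<theta> \<phi> / real n * (\<Sum>k = 1..n. (x k)\<^sup>2)
          + (1 / real n) * ((\<Sum>k = 1..n. beta x \<theta> \<phi> k)
            - (\<Sum>k\<in>K1 n x \<tau> \<theta> \<phi>. a_tilde \<theta> \<phi> * C_coeff x \<tau> \<theta> \<phi> k / (rs * a_tilde \<theta> \<phi> - 1)\<^sup>2))))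
      (at rs)"
      using has_derivative_dual_fun[OF a rs, of n x \<tau> \<mu> \<sigma> \<delta>] by simp
  qed
  show ?thesis using grid search by blast
qed

end
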